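(* Consider the equation $w_xE_x+w_yE_y+E(w_{xx}+w_{yy})=-1$ with $w=w(x,y)$ and $E=E(x,y)$ both dependent variables, and a nonclassical generator $\mathcal U=\xi\,\partial_x+\partial_y+\phi\,\partial_w+\psi\,\partial_E$ of this equation with $\xi=A(x,y)$ and $\phi=G(x,y,w)$. If $A\equiv 0$ and $G=y\mu(w)$, where $\mu$ is an arbitrary function, then the nonclassical generator is $$\mathcal U=\partial_y+y\,\mu(w)\,\partial_w-y\,\mu'(w)E\,\partial_E .$$
   Context: All functions are assumed real analytic on open domains, and $E\neq 0$. Put $F=w_xE_x+w_yE_y+E(w_{xx}+w_{yy})+1$ on the second-order jet space with independent variables $x,y$ and dependent variables $w,E$. For a vector field $\mathcal U=\xi\,\partial_x+\partial_y+\phi\,\partial_w+\psi\,\partial_E$ with $\xi,\phi,\psi$ functions of $(x,y,w,E)$ (the coefficient of $\partial_y$ is normalized to $1$), put $\phi_1=\xi w_x+w_y-\phi$ and $\phi_2=\xi E_x+E_y-\psi$. $\mathcal U$ is called a nonclassical generator (generator of a nonclassical equivalence transformation, or conditional symmetry) of the equation $F=0$ if $\mathrm{pr}^{(2)}\mathcal U(F)=0$, $\mathrm{pr}^{(1)}\mathcal U(\phi_1)=0$ and $\mathrm{pr}^{(1)}\mathcal U(\phi_2)=0$ at all jet points where $F=0$, $\phi_1=\phi_2=0$, and the total derivatives of $\phi_1,\phi_2$ with respect to $x$ and $y$ vanish. Here $\mathrm{pr}^{(n)}\mathcal U$ is the usual $n$-th prolongation ($x,y$ independent, $w,E$ dependent).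 A statement that "the nonclassical generator" with prescribed $\xi$ and $\phi$ is a given vector field means that this vector field is a nonclassical generator and is the one with those $\xi,\phi$. *)

theory Defs
  imports "HOL-Analysis.Analysis"
begin

text \<open>Real analyticity: near every point of the set the function is the sum of an
  (unconditionally convergent) power series in the coordinates. Multi-indices are functions on
  \<open>Basis\<close>, made extensional so that each one occurs exactly once.\<close>

definition real_analytic_on :: "('a::euclidean_space \<Rightarrow> real) \<Rightarrow> 'a set \<Rightarrow> bool"
    (infixl "real'_analytic'_on" 50) where
  "f real_analytic_on S \<longleftrightarrow>
    (\<forall>a\<in>S. \<exists>c. \<exists>r>0. \<forall>x\<in>ball a r.
       ((\<lambda>\<alpha>. c \<alpha> * (\<Prod>b\<in>Basis. ((x - a) \<bullet> b) ^ \<alpha> b)) has_sum f x) (Basis \<rightarrow>\<^sub>E (UNIV :: nat set)))"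

text \<open>Jet coordinates:
  \<open>jet0\<close> is \<open>(x, y, w, E)\<close>,
  \<open>jet1\<close> is \<open>(jet0, w_x, w_y, E_x, E_y)\<close>,
  \<open>jet2\<close> is \<open>(jet1, w_xx, w_xy, w_yy, E_xx, E_xy, E_yy)\<close>.\<close>

type_synonym jet0 = "real \<times> real \<times> real \<times> real"
type_synonym jet1 = "jet0 \<times> real \<times> real \<times> real \<times> real"
type_synonym jet2 = "jet1 \<times> real \<times> real \<times> real \<times> real \<times> real \<times> real"

text \<open>Total derivatives, raising the jet order by one: \<open>Dx0\<close>, \<open>Dy0\<close> act on functions on
  \<open>jet0\<close>, and \<open>Dx1\<close>, \<open>Dy1\<close> on functions on \<open>jet1\<close>. The argument of the Frechet derivative
  collects the coefficients of the total derivative operator, so that for example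
  \<open>Dx0 f = f\<^sub>x + w_x f\<^sub>w + E_x f\<^sub>E\<close>.\<close>

fun Dx0 :: "(jet0 \<Rightarrow> real) \<Rightarrow> jet1 \<Rightarrow> real" where
  "Dx0 f (p, wx, wy, ex, ey) = frechet_derivative f (at p) (1, 0, wx, ex)"

fun Dy0 :: "(jet0 \<Rightarrow> real) \<Rightarrow> jet1 \<Rightarrow> real" where
  "Dy0 f (p, wx, wy, ex, ey) = frechet_derivative f (at p) (0, 1, wy, ey)"

fun Dx1 :: "(jet1 \<Rightarrow> real) \<Rightarrow> jet2 \<Rightarrow> real" where
  "Dx1 f ((p, wx, wy, ex, ey), wxx, wxy, wyy, exx, exy, eyy) =
     frechet_derivative f (at (p, wx, wy, ex, ey)) ((1, 0, wx, ex), wxx, wxy, exx, exy)"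

fun Dy1 :: "(jet1 \<Rightarrow> real) \<Rightarrow> jet2 \<Rightarrow> real" where
  "Dy1 f ((p, wx, wy, ex, ey), wxx, wxy, wyy, exx, exy, eyy) =
     frechet_derivative f (at (p, wx, wy, ex, ey)) ((0, 1, wy, ey), wxy, wyy, exy, eyy)"

definition vf_apply :: "('a::euclidean_space \<Rightarrow> 'a) \<Rightarrow> ('a \<Rightarrow> real) \<Rightarrow> 'a \<Rightarrow> real" where
  "vf_apply V f p = frechet_derivative f (at p) (V p)"

text \<open>A vector field on \<open>jet0\<close> is given by its coefficients \<open>\<xi>\<close>, \<open>\<eta>\<close>, \<open>\<phi>\<close>, \<open>\<psi>\<close> with
  respect to \<open>x\<close>, \<open>y\<close>, \<open>w\<close>, \<open>E\<close>. Prolongation coefficients of a dependent variable \<open>u\<close>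
  with coefficient \<open>q\<close> follow the recursion
  \<open>q\<^sup>x = D\<^sub>x q - u_x D\<^sub>x \<xi> - u_y D\<^sub>x \<eta>\<close> and
  \<open>q\<^sup>x\<^sup>x = D\<^sub>x q\<^sup>x - u_xx D\<^sub>x \<xi> - u_xy D\<^sub>x \<eta>\<close>, similarly for the other derivatives.
  \<open>coeff1\<close> is the first-order step; its first argument is the total derivative, and
  \<open>ux\<close>, \<open>uy\<close> are the coordinate functions of the derivatives of \<open>u\<close>.\<close>

definition coeff1 ::
  "((jet0 \<Rightarrow> real) \<Rightarrow> jet1 \<Rightarrow> real) \<Rightarrow> (jet0 \<Rightarrow> real) \<Rightarrow> (jet0 \<Rightarrow> real) \<Rightarrow> (jet0 \<Rightarrow> real) \<Rightarrow>
   (jet1 \<Rightarrow> real) \<Rightarrow> (jet1 \<Rightarrow> real) \<Rightarrow> jet1 \<Rightarrow> real" where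
  "coeff1 D \<xi> \<eta> q ux uy j = D q j - ux j * D \<xi> j - uy j * D \<eta> j"

definition w_x :: "jet1 \<Rightarrow> real" where "w_x = (\<lambda>(p, wx, wy, ex, ey). wx)"
definition w_y :: "jet1 \<Rightarrow> real" where "w_y = (\<lambda>(p, wx, wy, ex, ey). wy)"
definition E_x :: "jet1 \<Rightarrow> real" where "E_x = (\<lambda>(p, wx, wy, ex, ey). ex)"
definition E_y :: "jet1 \<Rightarrow> real" where "E_y = (\<lambda>(p, wx, wy, ex, ey). ey)"

definition pr1 ::
  "(jet0 \<Rightarrow> real) \<Rightarrow> (jet0 \<Rightarrow> real) \<Rightarrow> (jet0 \<Rightarrow> real) \<Rightarrow> (jet0 \<Rightarrow> real) \<Rightarrow> jet1 \<Rightarrow> jet1" where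
  "pr1 \<xi> \<eta> \<phi> \<psi> j =
     ((\<xi> (fst j), \<eta> (fst j), \<phi> (fst j), \<psi> (fst j)),
      coeff1 Dx0 \<xi> \<eta> \<phi> w_x w_y j, coeff1 Dy0 \<xi> \<eta> \<phi> w_x w_y j,
      coeff1 Dx0 \<xi> \<eta> \<psi> E_x E_y j, coeff1 Dy0 \<xi> \<eta> \<psi> E_x E_y j)"

fun pr2 ::
  "(jet0 \<Rightarrow> real) \<Rightarrow> (jet0 \<Rightarrow> real) \<Rightarrow> (jet0 \<Rightarrow> real) \<Rightarrow> (jet0 \<Rightarrow> real) \<Rightarrow> jet2 \<Rightarrow> jet2" where
  "pr2 \<xi> \<eta> \<phi> \<psi> (i, wxx, wxy, wyy, exx, exy, eyy) =
     (let j = (i, wxx, wxy, wyy, exx, exy, eyy);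
          \<phi>x = coeff1 Dx0 \<xi> \<eta> \<phi> w_x w_y; \<phi>y = coeff1 Dy0 \<xi> \<eta> \<phi> w_x w_y;
          \<psi>x = coeff1 Dx0 \<xi> \<eta> \<psi> E_x E_y; \<psi>y = coeff1 Dy0 \<xi> \<eta> \<psi> E_x E_y
      in (pr1 \<xi> \<eta> \<phi> \<psi> i,
          Dx1 \<phi>x j - wxx * Dx0 \<xi> i - wxy * Dx0 \<eta> i,
          Dy1 \<phi>x j - wxx * Dy0 \<xi> i - wxy * Dy0 \<eta> i,
          Dy1 \<phi>y j - wxy * Dy0 \<xi> i - wyy * Dy0 \<eta> i,
          Dx1 \<psi>x j - exx * Dx0 \<xi> i - exy * Dx0 \<eta> i,
          Dy1 \<psi>x j - exx * Dy0 \<xi> i - exy * Dy0 \<eta> i,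
          Dy1 \<psi>y j - exy * Dy0 \<xi> i - eyy * Dy0 \<eta> i))"

text \<open>The invariant surface functions \<open>\<phi>\<^sub>1\<close> and \<open>\<phi>\<^sub>2\<close>, for \<open>\<eta> = 1\<close>.\<close>

definition surf_w :: "(jet0 \<Rightarrow> real) \<Rightarrow> (jet0 \<Rightarrow> real) \<Rightarrow> jet1 \<Rightarrow> real" where
  "surf_w \<xi> \<phi> j = \<xi> (fst j) * w_x j + w_y j - \<phi> (fst j)"

definition surf_E :: "(jet0 \<Rightarrow> real) \<Rightarrow> (jet0 \<Rightarrow> real) \<Rightarrow> jet1 \<Rightarrow> real" where
  "surf_E \<xi> \<psi> j = \<xi> (fst j) * E_x j + E_y j - \<psi> (fst j)"

text \<open>The vector field \<open>\<xi> \<partial>\<^sub>x + \<partial>\<^sub>y + \<phi> \<partial>\<^sub>w + \<psi> \<partial>\<^sub>E\<close> on \<open>\<Omega>\<close> is a nonclassical generator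
  of the equation \<open>F = 0\<close>.\<close>

definition nonclassical_generator ::
  "(jet2 \<Rightarrow> real) \<Rightarrow> jet0 set \<Rightarrow> (jet0 \<Rightarrow> real) \<Rightarrow> (jet0 \<Rightarrow> real) \<Rightarrow> (jet0 \<Rightarrow> real) \<Rightarrow> bool" where
  "nonclassical_generator F \<Omega> \<xi> \<phi> \<psi> \<longleftrightarrow>
     \<xi> real_analytic_on \<Omega> \<and> \<phi> real_analytic_on \<Omega> \<and> \<psi> real_analytic_on \<Omega> \<and>
     (\<forall>j :: jet2. fst (fst j) \<in> \<Omega> \<and> F j = 0 \<and>
        surf_w \<xi> \<phi> (fst j) = 0 \<and> surf_E \<xi> \<psi> (fst j) = 0 \<and>
        Dx1 (surf_w \<xi> \<phi>) j = 0 \<and> Dy1 (surf_w \<xi> \<phi>) j = 0 \<and>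
        Dx1 (surf_E \<xi> \<psi>) j = 0 \<and> Dy1 (surf_E \<xi> \<psi>) j = 0 \<longrightarrow>
        vf_apply (pr2 \<xi> (\<lambda>_. 1) \<phi> \<psi>) F j = 0 \<and>
        vf_apply (pr1 \<xi> (\<lambda>_. 1) \<phi> \<psi>) (surf_w \<xi> \<phi>) (fst j) = 0 \<and>
        vf_apply (pr1 \<xi> (\<lambda>_. 1) \<phi> \<psi>) (surf_E \<xi> \<psi>) (fst j) = 0)"

fun eqn_F :: "jet2 \<Rightarrow> real" where
  "eqn_F (((x, y, w, E), wx, wy, ex, ey), wxx, wxy, wyy, exx, exy, eyy) =
     wx * ex + wy * ey + E * (wxx + wyy) + 1"

end

theory Submission
  imports Defs
begin

text \<open>For \<open>\<xi> = 0\<close> and \<open>\<phi> = y \<mu>(w)\<close> the invariance condition, restricted to the invariant surface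
  and to \<open>F = 0\<close>, is a polynomial in the free jet coordinates \<open>w_x\<close> and \<open>E_x\<close>. The coefficient of
  \<open>w_x E_x\<close> gives \<open>\<psi>\<^sub>E = \<psi> / E\<close>, so \<open>\<psi>\<close> is locally linear in \<open>E\<close>. The coefficient of
  \<open>w_x\<^sup>2\<close> determines \<open>\<psi>\<^sub>w\<close>, and the constant term then reads
  \<open>\<psi> / E + y \<mu>' = \<mu> \<psi> + y \<mu> \<psi>\<^sub>y + 2 E \<mu>' y \<mu>\<close>: the left-hand side is homogeneous of degree 0 in \<open>E\<close>,
  the right-hand side of degree 1, hence both vanish and \<open>\<psi> = - y \<mu>' E\<close>.\<close>

section \<open>Real analytic functions\<close>

lemma real_analytic_on_subset:
  "f real_analytic_on T \<Longrightarrow> S \<subseteq> T \<Longrightarrow> f real_analytic_on S"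
  unfolding real_analytic_on_def by blast

text \<open>In dimension one \<open>Basis\<close> is \<open>{1}\<close>, so an extensional
  multi-index is just its value at 1, and reindexing by that value turns the series into an ordinary
  one.\<close>

lemma real_analytic_on_power_series:
  fixes f :: "real \<Rightarrow> real"
  assumes "f real_analytic_on S" "a \<in> S"
  shows "\<exists>c. \<exists>r>0. \<forall>x\<in>ball a r. ((\<lambda>n. c n * (x - a) ^ n) has_sum f x) UNIV"
proof -
  obtain c r where "r > 0" and "\<forall>x\<in>ball a r.
      ((\<lambda>\<alpha>. c \<alpha> * (\<Prod>b\<in>Basis. ((x - a) \<bullet> b) ^ \<alpha> b)) has_sum f x) (Basis \<rightarrow>\<^sub>E UNIV)"
    using assms unfolding real_analytic_on_def by blast
  then have c: "\<forall>x\<in>ball a r.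
      ((\<lambda>\<alpha>. c \<alpha> * (x - a) ^ \<alpha> 1) has_sum f x) ({1} \<rightarrow>\<^sub>E (UNIV :: nat set))"
    by simp
  define h :: "nat \<Rightarrow> real \<Rightarrow> nat" where "h = (\<lambda>n. \<lambda>i\<in>{1}. n)"
  have bij: "bij_betw h UNIV ({1} \<rightarrow>\<^sub>E UNIV)"
    by (rule bij_betwI[of _ _ _ "\<lambda>\<alpha>. \<alpha> 1"])
      (auto simp: h_def fun_eq_iff PiE_def extensional_def)
  have "((\<lambda>n. c (h n) * (x - a) ^ n) has_sum f x) UNIV" if "x \<in> ball a r" for x
    using has_sum_reindex_bij_betw[OF bij, of "\<lambda>\<alpha>. c \<alpha> * (x - a) ^ \<alpha> 1" "f x"] c that
    by (simp add: h_def)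
  with \<open>r > 0\<close> show ?thesis by (intro exI[of _ "\<lambda>n. c (h n)"] exI[of _ r]) simp
qed

text \<open>The one-variable series is placed on the multi-indices supported at \<open>b\<close>.
  The hypothesis is phrased as a series so that it also accepts a function, such as a derivative,
  known only through its expansions.\<close>

lemma real_analytic_on_coordinate:
  fixes b :: "'a::euclidean_space"
  assumes b: "b \<in> Basis"
    and f: "\<And>a. a \<in> S \<Longrightarrow> \<exists>c. \<exists>r>0. \<forall>x\<in>ball a r. ((\<lambda>n. c n * (x - a) ^ n) has_sum f x) UNIV"
  shows "(\<lambda>p. f (p \<bullet> b)) real_analytic_on {p. p \<bullet> b \<in> S}"
  unfolding real_analytic_on_def
proof
  fix a assume "a \<in> {p. p \<bullet> b \<in> S}"
  then obtain c r where "r > 0" and c: "\<forall>x\<in>ball (a \<bullet> b) r.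
      ((\<lambda>n. c n * (x - a \<bullet> b) ^ n) has_sum f x) UNIV"
    using f[of "a \<bullet> b"] by blast
  define h :: "nat \<Rightarrow> 'a \<Rightarrow> nat" where "h = (\<lambda>n. \<lambda>i\<in>Basis. if i = b then n else 0)"
  have inj: "inj h"
    by (rule injI) (use b in \<open>auto simp: h_def fun_eq_iff split: if_splits\<close>)
  \<comment> \<open>\<open>h n\<close> is the multi-index with \<open>n\<close> at \<open>b\<close>
    and 0 elsewhere; \<open>C\<close> extends the coefficients by 0 to all other
    multi-indices.\<close>
  define C where "C \<alpha> = (if \<alpha> \<in> range h then c (\<alpha> b) else 0)" for \<alpha>
  have "((\<lambda>\<alpha>. C \<alpha> * (\<Prod>i\<in>Basis. ((x - a) \<bullet> i) ^ \<alpha> i)) has_sum f (x \<bullet> b)) (Basis \<rightarrow>\<^sub>E UNIV)"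
    if "x \<in> ball a r" for x
  proof -
    have "\<bar>x \<bullet> b - a \<bullet> b\<bar> \<le> norm (x - a)"
      using Basis_le_norm[OF b, of "x - a"] by (simp add: inner_diff_left)
    then have "x \<bullet> b \<in> ball (a \<bullet> b) r"
      using that by (simp add: dist_norm norm_minus_commute abs_minus_commute)
    with c have *: "((\<lambda>n. c n * (x \<bullet> b - a \<bullet> b) ^ n) has_sum f (x \<bullet> b)) UNIV" by blast
    have "C (h n) * (\<Prod>i\<in>Basis. ((x - a) \<bullet> i) ^ h n i) = c n * (x \<bullet> b - a \<bullet> b) ^ n" for n
    proof -
      have "(\<Prod>i\<in>Basis. ((x - a) \<bullet> i) ^ h n i)
          = (\<Prod>i\<in>Basis. if i = b then ((x - a) \<bullet> b) ^ n else 1)"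
        by (intro prod.cong) (auto simp: h_def)
      also have "\<dots> = ((x - a) \<bullet> b) ^ n" using b by simp
      finally show ?thesis using b by (simp add: C_def h_def inner_diff_left)
    qed
    with * have "((\<lambda>\<alpha>. C \<alpha> * (\<Prod>i\<in>Basis. ((x - a) \<bullet> i) ^ \<alpha> i)) has_sum f (x \<bullet> b)) (range h)"
      by (simp add: has_sum_reindex[OF inj] o_def)
    then show ?thesis
      by (rule has_sum_cong_neutral[THEN iffD1, rotated -1]) (auto simp: C_def h_def)
  qed
  then show "\<exists>c. \<exists>r>0. \<forall>x\<in>ball a r. ((\<lambda>\<alpha>. c \<alpha> * (\<Prod>b\<in>Basis. ((x - a) \<bullet> b) ^ \<alpha> b))
      has_sum f (x \<bullet> b)) (Basis \<rightarrow>\<^sub>E UNIV)"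
    using \<open>r > 0\<close> by blast
qed

text \<open>Split the factor \<open>x \<bullet> b\<close> as \<open>a \<bullet> b\<close> plus
  \<open>(x - a) \<bullet> b\<close>: the first part scales the coefficients, the second raises the
  exponent at \<open>b\<close> by one.\<close>

lemma real_analytic_on_mult_coordinate:
  fixes b :: "'a::euclidean_space"
  assumes b: "b \<in> Basis" and f: "f real_analytic_on S"
  shows "(\<lambda>p. (p \<bullet> b) * f p) real_analytic_on S"
  unfolding real_analytic_on_def
proof
  fix a assume "a \<in> S"
  let ?I = "Basis \<rightarrow>\<^sub>E (UNIV :: nat set)"
  let ?m = "\<lambda>x \<alpha>. \<Prod>i\<in>Basis. ((x - a) \<bullet> i) ^ \<alpha> i"
  obtain c r where "r > 0" and c: "\<And>x. x \<in> ball a r \<Longrightarrow> ((\<lambda>\<alpha>. c \<alpha> * ?m x \<alpha>) has_sum f x) ?I"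
    using f \<open>a \<in> S\<close> unfolding real_analytic_on_def by blast
  define h where "h = (\<lambda>\<alpha> :: 'a \<Rightarrow> nat. \<alpha>(b := Suc (\<alpha> b)))"
  \<comment> \<open>\<open>k\<close> undoes the shift \<open>h\<close>. It is applied only to
    multi-indices in the image of \<open>h\<close>, whose exponent at \<open>b\<close> is positive,
    so the subtraction is never truncated.\<close>
  define k where "k = (\<lambda>\<alpha> :: 'a \<Rightarrow> nat. \<alpha>(b := \<alpha> b - 1))"
  have kh: "k (h \<alpha>) = \<alpha>" for \<alpha> by (simp add: h_def k_def)
  have inj: "inj_on h ?I" by (rule inj_on_inverseI) (rule kh)
  define C where "C \<alpha> = (if \<alpha> \<in> h ` ?I then c (k \<alpha>) else 0)" for \<alpha>
  have "((\<lambda>\<alpha>. ((a \<bullet> b) * c \<alpha> + C \<alpha>) * ?m x \<alpha>) has_sum (x \<bullet> b) * f x) ?I"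
    if x: "x \<in> ball a r" for x
  proof -
    have 1: "((\<lambda>\<alpha>. (a \<bullet> b) * (c \<alpha> * ?m x \<alpha>)) has_sum (a \<bullet> b) * f x) ?I"
      by (intro has_sum_cmult_right c x)
    have 2: "((\<lambda>\<alpha>. ((x - a) \<bullet> b) * (c \<alpha> * ?m x \<alpha>)) has_sum ((x - a) \<bullet> b) * f x) ?I"
      by (intro has_sum_cmult_right c x)
    have "C (h \<alpha>) * ?m x (h \<alpha>) = ((x - a) \<bullet> b) * (c \<alpha> * ?m x \<alpha>)" if "\<alpha> \<in> ?I" for \<alpha>
    proof -
      have "?m x (h \<alpha>) = ((x - a) \<bullet> b) ^ Suc (\<alpha> b) * (\<Prod>i\<in>Basis - {b}. ((x - a) \<bullet> i) ^ h \<alpha> i)"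
        using b by (subst prod.remove[of _ b]) (auto simp: h_def)
      also have "(\<Prod>i\<in>Basis - {b}. ((x - a) \<bullet> i) ^ h \<alpha> i) = (\<Prod>i\<in>Basis - {b}. ((x - a) \<bullet> i) ^ \<alpha> i)"
        by (intro prod.cong) (auto simp: h_def)
      also have "((x - a) \<bullet> b) ^ Suc (\<alpha> b) * \<dots> = ((x - a) \<bullet> b) * ?m x \<alpha>"
        using b by (subst prod.remove[of Basis b "\<lambda>i. ((x - a) \<bullet> i) ^ \<alpha> i"]) auto
      finally show ?thesis using that by (simp add: C_def kh)
    qed
    then have "((\<lambda>\<alpha>. C (h \<alpha>) * ?m x (h \<alpha>)) has_sum ((x - a) \<bullet> b) * f x) ?I"
      using 2 by (subst has_sum_cong) auto
    then have "((\<lambda>\<alpha>. C \<alpha> * ?m x \<alpha>) has_sum ((x - a) \<bullet> b) * f x) (h ` ?I)"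
      by (simp add: has_sum_reindex[OF inj] o_def)
    then have "((\<lambda>\<alpha>. C \<alpha> * ?m x \<alpha>) has_sum ((x - a) \<bullet> b) * f x) ?I"
    proof (rule has_sum_cong_neutral[THEN iffD1, rotated -1])
      have "h ` ?I \<subseteq> ?I" using b by (auto simp: h_def PiE_def extensional_def)
      then show "C \<alpha> * ?m x \<alpha> = 0" if "\<alpha> \<in> h ` ?I - ?I" for \<alpha> using that by blast
    qed (auto simp: C_def)
    from has_sum_add[OF 1 this] show ?thesis
      by (simp add: algebra_simps inner_diff_left)
  qed
  then show "\<exists>c. \<exists>r>0. \<forall>x\<in>ball a r. ((\<lambda>\<alpha>. c \<alpha> * ?m x \<alpha>) has_sum (x \<bullet> b) * f x) ?I"
    using \<open>r > 0\<close> by (intro exI[of _ "\<lambda>\<alpha>. (a \<bullet> b) * c \<alpha> + C \<alpha>"] exI[of _ r]) blast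
qed

lemma real_analytic_on_uminus:
  assumes "f real_analytic_on S"
  shows "(\<lambda>p. - f p) real_analytic_on S"
  unfolding real_analytic_on_def
proof
  fix a assume "a \<in> S"
  let ?I = "Basis \<rightarrow>\<^sub>E (UNIV :: nat set)"
  let ?m = "\<lambda>x \<alpha>. \<Prod>i\<in>Basis. ((x - a) \<bullet> i) ^ \<alpha> i"
  obtain c r where "r > 0" and c: "\<And>x. x \<in> ball a r \<Longrightarrow> ((\<lambda>\<alpha>. c \<alpha> * ?m x \<alpha>) has_sum f x) ?I"
    using assms \<open>a \<in> S\<close> unfolding real_analytic_on_def by blast
  have "((\<lambda>\<alpha>. - c \<alpha> * ?m x \<alpha>) has_sum - f x) ?I" if "x \<in> ball a r" for x
    using has_sum_uminusI[OF c[OF that]] by simp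
  with \<open>r > 0\<close> show "\<exists>c. \<exists>r>0. \<forall>x\<in>ball a r. ((\<lambda>\<alpha>. c \<alpha> * ?m x \<alpha>) has_sum - f x) ?I"
    by (intro exI[of _ "\<lambda>\<alpha>. - c \<alpha>"] exI[of _ r]) blast
qed

text \<open>Termwise differentiation gives an ordinary convergent series; what remains is
  unconditional convergence, as \<open>has_sum\<close> demands.\<close>

lemma deriv_power_series:
  fixes f :: "real \<Rightarrow> real"
  assumes f: "f real_analytic_on S" and a: "a \<in> S"
  shows "\<exists>c. \<exists>r>0. \<forall>x\<in>ball a r. ((\<lambda>n. c n * (x - a) ^ n) has_sum deriv f x) UNIV"
proof -
  obtain c r where "r > 0"
    and c: "\<And>x. x \<in> ball a r \<Longrightarrow> ((\<lambda>n. c n * (x - a) ^ n) has_sum f x) UNIV"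
    using real_analytic_on_power_series[OF assms] by blast
  have s: "summable (\<lambda>n. c n * z ^ n)" if "norm z < r" for z :: real
    using has_sum_imp_sums[OF c[of "a + z"]] that by (auto simp: dist_norm sums_iff)
  have "((\<lambda>n. diffs c n * (x - a) ^ n) has_sum deriv f x) UNIV" if x: "x \<in> ball a r" for x
  proof -
    have xr: "norm (x - a) < r" using x by (simp add: dist_norm norm_minus_commute)
    have shift: "((\<lambda>z. z - a) has_real_derivative 1) (at x)"
      by (auto intro!: derivative_eq_intros)
    have "((\<lambda>z. \<Sum>n. c n * z ^ n) has_real_derivative (\<Sum>n. diffs c n * (x - a) ^ n)) (at (x - a))"
      using termdiffs_strong'[OF s xr] by auto
    then have "((\<lambda>z. \<Sum>n. c n * (z - a) ^ n) has_real_derivative (\<Sum>n. diffs c n * (x - a) ^ n)) (at x)"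
      using DERIV_chain'[OF shift, of "\<lambda>z. \<Sum>n. c n * z ^ n"] by simp
    then have "(f has_real_derivative (\<Sum>n. diffs c n * (x - a) ^ n)) (at x)"
      by (rule has_field_derivative_transform_within_open[of _ _ _ "ball a r"])
        (use x has_sum_imp_sums[OF c] in \<open>auto simp: sums_iff\<close>)
    then have d: "deriv f x = (\<Sum>n. diffs c n * (x - a) ^ n)" by (rule DERIV_imp_deriv)
    \<comment> \<open>A point \<open>t\<close> strictly between \<open>norm (x - a)\<close> and
      \<open>r\<close>: convergence of the differentiated series at \<open>t\<close> makes it
      absolutely convergent at the smaller argument \<open>x - a\<close>.\<close>
    obtain t where t: "norm (x - a) < t" "t < r" using xr dense by blast
    have "summable (\<lambda>n. diffs c n * t ^ n)"
    proof (rule termdiff_converges[OF _ s])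
      have "0 < t" using t(1) by (rule le_less_trans[OF norm_ge_zero])
      then show "norm t < r" using t(2) by simp
    qed
    then have "summable (\<lambda>n. norm (diffs c n * (x - a) ^ n))"
      by (rule powser_insidea) (use t in auto)
    from norm_summable_imp_has_sum[OF this summable_sums[OF summable_norm_cancel[OF this]]]
    have "((\<lambda>n. diffs c n * (x - a) ^ n) has_sum (\<Sum>n. diffs c n * (x - a) ^ n)) UNIV" .
    then show ?thesis by (simp add: d)
  qed
  with \<open>r > 0\<close> show ?thesis by blast
qed

text \<open>On the line the only coordinate is the variable itself, so the coordinate lemma with
  basis vector 1 restores the multi-index form.\<close>

lemma real_analytic_on_deriv:
  fixes f :: "real \<Rightarrow> real"
  assumes "f real_analytic_on S"
  shows "deriv f real_analytic_on S"
  using real_analytic_on_coordinate[of "1::real" S "deriv f"] deriv_power_series[OF assms] by simp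

text \<open>Only the centre \<open>a\<close> of an expansion is treated. The point \<open>u\<close>, all of whose coordinates
  relative to \<open>a\<close> equal \<open>s\<close>, gives absolute convergence with weights \<open>s\<close> to the degree, which bounds
  the terms of degree at least 2 by a multiple of \<open>(norm h)\<^sup>2\<close>.\<close>

lemma real_analytic_on_imp_differentiable:
  fixes f :: "'a::euclidean_space \<Rightarrow> real"
  assumes "f real_analytic_on S" "a \<in> S"
  shows "f differentiable (at a)"
proof -
  let ?I = "Basis \<rightarrow>\<^sub>E (UNIV :: nat set)"
  let ?m = "\<lambda>h \<alpha>. \<Prod>i\<in>Basis. (h \<bullet> i) ^ \<alpha> i"
  obtain c r where "r > 0" and c': "\<And>x. x \<in> ball a r \<Longrightarrow> ((\<lambda>\<alpha>. c \<alpha> * ?m (x - a) \<alpha>) has_sum f x) ?I"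
    using assms unfolding real_analytic_on_def by blast
  have c: "((\<lambda>\<alpha>. c \<alpha> * ?m h \<alpha>) has_sum f (a + h)) ?I" if "norm h < r" for h
    using c'[of "a + h"] that by (simp add: dist_norm)
  \<comment> \<open>\<open>z\<close> is the zero multi-index and \<open>e b\<close> the unit one at
    \<open>b\<close>, so \<open>J\<close> collects the degrees 0 and 1. \<open>L\<close> is the
    linear part of the series, hence the prospective derivative.\<close>
  define z where "z = (\<lambda>i\<in>Basis :: 'a set. 0 :: nat)"
  define e where "e b = (\<lambda>i\<in>Basis. if i = b then 1 else 0 :: nat)" for b :: 'a
  define J where "J = insert z (e ` Basis)"
  define L where "L h = (\<Sum>b\<in>Basis. c (e b) * (h \<bullet> b))" for h
  have J: "finite J" "J \<subseteq> ?I" by (auto simp: J_def z_def e_def)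
  have inj: "inj_on e Basis"
    by (rule inj_onI) (auto simp: e_def fun_eq_iff split: if_splits)
  have z: "z \<notin> e ` Basis" by (auto simp: z_def e_def fun_eq_iff split: if_splits)
  have me: "?m h (e b) = h \<bullet> b" if "b \<in> Basis" for h b
  proof -
    have "?m h (e b) = (\<Prod>i\<in>Basis. if i = b then h \<bullet> b else 1)"
      by (intro prod.cong) (auto simp: e_def)
    also have "\<dots> = h \<bullet> b" using that by simp
    finally show ?thesis .
  qed
  have sumJ: "(\<Sum>\<alpha>\<in>J. c \<alpha> * ?m h \<alpha>) = c z + L h" for h
    using z by (simp add: J_def sum.reindex[OF inj] L_def me) (simp add: z_def)
  have rest: "((\<lambda>\<alpha>. c \<alpha> * ?m h \<alpha>) has_sum f (a + h) - (c z + L h)) (?I - J)" if "norm h < r" for h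
    using has_sum_Diff[OF c[OF that] has_sum_finite[OF J(1)] J(2)] by (simp add: sumJ)
  have deg: "sum \<alpha> Basis \<ge> 2" if "\<alpha> \<in> ?I - J" for \<alpha>
  proof (rule ccontr)
    assume "\<not> sum \<alpha> Basis \<ge> 2"
    then consider "sum \<alpha> Basis = 0" | "sum \<alpha> Basis = 1" by linarith
    then show False
    proof cases
      case 1
      then have "\<alpha> = z" using that by (auto simp: z_def fun_eq_iff PiE_def extensional_def)
      then show False using that by (simp add: J_def)
    next
      case 2
      then obtain b where b: "b \<in> Basis" "\<alpha> b = 1" "\<forall>i\<in>Basis. b \<noteq> i \<longrightarrow> \<alpha> i = 0"
        using sum_eq_1_iff[of "Basis :: 'a set" \<alpha>] by auto
      then have "\<alpha> = e b" using that by (auto simp: e_def fun_eq_iff PiE_def extensional_def)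
      then show False using that b by (simp add: J_def)
    qed
  qed
  \<comment> \<open>The point \<open>u\<close> has norm at most DIM times \<open>s\<close>; the
    extra 1 in the denominator keeps this strictly below \<open>r\<close>, so the series converges
    at \<open>u\<close>.\<close>
  define s where "s = r / (1 + real DIM('a))"
  have "s > 0" using \<open>r > 0\<close> by (simp add: s_def add_pos_nonneg)
  define u where "u = (\<Sum>b\<in>Basis. s *\<^sub>R b :: 'a)"
  have "norm u \<le> real DIM('a) * s"
    unfolding u_def by (rule sum_norm_bound) (use \<open>s > 0\<close> in simp)
  also have "\<dots> < r"
    using \<open>r > 0\<close> by (simp add: s_def field_simps)
  finally have "norm u < r" .
  define g where "g \<alpha> = \<bar>c \<alpha>\<bar> * s ^ sum \<alpha> Basis" for \<alpha>
  have mu: "?m u \<alpha> = s ^ sum \<alpha> Basis" for \<alpha>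
    by (simp add: u_def power_sum)
  have "(\<lambda>\<alpha>. norm (c \<alpha> * ?m u \<alpha>)) summable_on ?I - J"
    using rest[OF \<open>norm u < r\<close>, THEN has_sum_imp_summable]
    by (rule summable_on_iff_abs_summable_on_real[THEN iffD1])
  then have g: "g summable_on ?I - J"
    unfolding mu using \<open>s > 0\<close> by (simp add: g_def[abs_def] abs_mult)
  define M where "M = infsum g (?I - J)"
  have bound: "\<bar>f (a + h) - (c z + L h)\<bar> \<le> M / s\<^sup>2 * (norm h)\<^sup>2" if h: "norm h < s" for h
  proof -
    \<comment> \<open>Since \<open>q\<close> is at most 1 and the remaining degrees are at least 2,
      \<open>q\<close> to the degree is at most \<open>q\<^sup>2\<close>; this yields the quadratic
      bound.\<close>
    define q where "q = norm h / s"
    have q: "0 \<le> q" "q \<le> 1" using h \<open>s > 0\<close> by (auto simp: q_def)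
    have "s \<le> r" using \<open>r > 0\<close> by (simp add: s_def field_simps)
    then have hr: "norm h < r" using h by simp
    have "\<bar>c \<alpha> * ?m h \<alpha>\<bar> \<le> g \<alpha> * q\<^sup>2" if "\<alpha> \<in> ?I - J" for \<alpha>
    proof -
      have "\<bar>?m h \<alpha>\<bar> \<le> (\<Prod>i\<in>Basis. norm h ^ \<alpha> i)"
        unfolding abs_prod by (intro prod_mono) (auto simp: power_abs intro!: power_mono Basis_le_norm)
      also have "\<dots> = (s * q) ^ sum \<alpha> Basis"
        using \<open>s > 0\<close> by (simp add: power_sum q_def)
      also have "\<dots> \<le> s ^ sum \<alpha> Basis * q\<^sup>2"
        unfolding power_mult_distrib
        using \<open>s > 0\<close> q deg[OF that] by (intro mult_left_mono power_decreasing) auto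
      finally show ?thesis by (simp add: abs_mult g_def mult_left_mono mult.assoc)
    qed
    then have "norm (f (a + h) - (c z + L h)) \<le> M * q\<^sup>2"
      unfolding M_def
      by (intro norm_infsum_le[OF rest[OF hr] has_sum_cmult_left[OF has_sum_infsum[OF g]]]) auto
    then show ?thesis by (simp add: q_def power_divide)
  qed
  have fa: "f a = c z"
    using bound[of 0] \<open>s > 0\<close> by (simp add: L_def)
  have "(f has_derivative L) (at a)"
  proof (rule has_derivativeI_sandwich[of s])
    show "bounded_linear L"
      unfolding L_def by (intro bounded_linear_sum bounded_linear_const_mult bounded_linear_inner_left)
    show "norm (f y - f a - L (y - a)) / norm (y - a) \<le> M / s\<^sup>2 * norm (y - a)"
      if "y \<noteq> a" "dist y a < s" for y
    proof -
      have "\<bar>f y - f a - L (y - a)\<bar> \<le> M / s\<^sup>2 * norm (y - a) * norm (y - a)"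
        using bound[of "y - a"] that(2)
        by (simp only: fa dist_norm power2_eq_square mult.assoc diff_diff_eq add_diff_cancel_left' add_diff_eq)
      then show ?thesis
        using that(1) by (simp only: real_norm_def pos_divide_le_eq zero_less_norm_iff right_minus_eq not_False_eq_True)
    qed
    show "((\<lambda>y. M / s\<^sup>2 * norm (y - a)) \<longlongrightarrow> 0) (at a)"
      using \<open>s > 0\<close> by (auto intro!: tendsto_eq_intros)
  qed fact
  then show ?thesis by (auto simp: differentiable_def)
qed

section \<open>Prolongations of the candidate vector field\<close>

lemma vf_apply_eqn_F:
  "vf_apply V eqn_F (((x, y, w, E), wx, wy, ex, ey), wxx, wxy, wyy, exx, exy, eyy) =
    (case V (((x, y, w, E), wx, wy, ex, ey), wxx, wxy, wyy, exx, exy, eyy) of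
      (((vx, vy, vw, vE), vwx, vwy, vex, vey), vwxx, vwxy, vwyy, _) \<Rightarrow>
        vwx * ex + wx * vex + vwy * ey + wy * vey + vE * (wxx + wyy) + E * (vwxx + vwyy))"
proof -
  let ?j = "(((x, y, w, E), wx, wy, ex, ey), wxx, wxy, wyy, exx, exy, eyy)"
  \<comment> \<open>Projections replace pattern matching so that the derivative rules apply.\<close>
  have F: "eqn_F = (\<lambda>j. fst (snd (fst j)) * fst (snd (snd (snd (fst j))))
      + fst (snd (snd (fst j))) * snd (snd (snd (snd (fst j))))
      + snd (snd (snd (fst (fst j)))) * (fst (snd j) + fst (snd (snd (snd j)))) + 1)"
    by (simp add: fun_eq_iff)
  have "(eqn_F has_derivative
      (\<lambda>v. fst (snd (fst v)) * ex + wx * fst (snd (snd (snd (fst v))))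
        + fst (snd (snd (fst v))) * ey + wy * snd (snd (snd (snd (fst v))))
        + snd (snd (snd (fst (fst v)))) * (wxx + wyy)
        + E * (fst (snd v) + fst (snd (snd (snd v)))))) (at ?j)"
    unfolding F by (rule derivative_eq_intros refl | simp add: fun_eq_iff)+
  from frechet_derivative_at[OF this, symmetric] show ?thesis
    by (simp add: vf_apply_def split: prod.splits)
qed

text \<open>The coefficients are prescribed on \<open>\<Omega>\<close> alone; as
  \<open>\<Omega>\<close> is open, this still determines their Frechet derivatives there.
  \<open>\<psi>\<close> is left unspecified so that the same prolongation formulas serve both
  uniqueness and verification.\<close>

locale nonclassical_candidate =
  fixes \<Omega> :: "jet0 set" and \<mu> \<mu>' \<mu>'' :: "real \<Rightarrow> real" and \<xi> \<phi> \<psi> :: "jet0 \<Rightarrow> real"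
  assumes open_dom: "open \<Omega>"
    and mu: "(x, y, w, E) \<in> \<Omega> \<Longrightarrow> (\<mu> has_real_derivative \<mu>' w) (at w)"
    and mu': "(x, y, w, E) \<in> \<Omega> \<Longrightarrow> (\<mu>' has_real_derivative \<mu>'' w) (at w)"
    and xi: "p \<in> \<Omega> \<Longrightarrow> \<xi> p = 0"
    and phi: "(x, y, w, E) \<in> \<Omega> \<Longrightarrow> \<phi> (x, y, w, E) = y * \<mu> w"
    and psi: "p \<in> \<Omega> \<Longrightarrow> \<psi> differentiable (at p)"
begin

abbreviation D\<psi> :: "jet0 \<Rightarrow> jet0 \<Rightarrow> real" where
  "D\<psi> p \<equiv> frechet_derivative \<psi> (at p)"

lemma D_xi: "p \<in> \<Omega> \<Longrightarrow> frechet_derivative \<xi> (at p) = (\<lambda>_. 0)"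
  by (rule frechet_derivative_at[symmetric],
      rule has_derivative_transform_within_open[OF has_derivative_const open_dom])
    (auto simp: xi)

lemma D_phi:
  assumes p: "(x, y, w, E) \<in> \<Omega>"
  shows "(\<phi> has_derivative (\<lambda>(_, dy, dw, _). dy * \<mu> w + y * \<mu>' w * dw)) (at (x, y, w, E))"
proof -
  let ?p = "(x, y, w, E)"
  have "((\<lambda>p. \<mu> (fst (snd (snd p)))) has_derivative (\<lambda>v. fst (snd (snd v)) * \<mu>' w)) (at ?p)"
    by (rule DERIV_compose_FDERIV) (auto intro!: derivative_eq_intros mu[OF p])
  then have "((\<lambda>p. fst (snd p) * \<mu> (fst (snd (snd p)))) has_derivative
      (\<lambda>(_, dy, dw, _). dy * \<mu> w + y * \<mu>' w * dw)) (at ?p)"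
    by (auto intro!: derivative_eq_intros simp: fun_eq_iff)
  then show ?thesis
    by (rule has_derivative_transform_within_open[OF _ open_dom p]) (auto simp: phi)
qed

lemmas frechet_phi = frechet_derivative_at[OF D_phi, symmetric]

lemma coeff1_phi_x:
  "(x, y, w, E) \<in> \<Omega> \<Longrightarrow>
    coeff1 Dx0 \<xi> (\<lambda>_. 1) \<phi> w_x w_y ((x, y, w, E), wx, wy, ex, ey) = y * \<mu>' w * wx"
  by (simp add: coeff1_def D_xi frechet_phi)

lemma coeff1_phi_y:
  "(x, y, w, E) \<in> \<Omega> \<Longrightarrow>
    coeff1 Dy0 \<xi> (\<lambda>_. 1) \<phi> w_x w_y ((x, y, w, E), wx, wy, ex, ey) = \<mu> w + y * \<mu>' w * wy"
  by (simp add: coeff1_def D_xi frechet_phi)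

lemma coeff1_psi_x:
  "p \<in> \<Omega> \<Longrightarrow> coeff1 Dx0 \<xi> (\<lambda>_. 1) \<psi> E_x E_y (p, wx, wy, ex, ey) = D\<psi> p (1, 0, wx, ex)"
  by (simp add: coeff1_def D_xi)

lemma coeff1_psi_y:
  "p \<in> \<Omega> \<Longrightarrow> coeff1 Dy0 \<xi> (\<lambda>_. 1) \<psi> E_x E_y (p, wx, wy, ex, ey) = D\<psi> p (0, 1, wy, ey)"
  by (simp add: coeff1_def D_xi)

lemma D_coeff1_phi_x:
  assumes p: "(x, y, w, E) \<in> \<Omega>"
  shows "frechet_derivative (coeff1 Dx0 \<xi> (\<lambda>_. 1) \<phi> w_x w_y) (at ((x, y, w, E), wx, wy, ex, ey)) =
    (\<lambda>((_, dy, dw, _), dwx, _). dy * \<mu>' w * wx + y * \<mu>'' w * dw * wx + y * \<mu>' w * dwx)"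
proof -
  let ?j = "((x, y, w, E), wx, wy, ex, ey)"
  have "((\<lambda>j. \<mu>' (fst (snd (snd (fst j))))) has_derivative (\<lambda>v. fst (snd (snd (fst v))) * \<mu>'' w)) (at ?j)"
    by (rule DERIV_compose_FDERIV) (auto intro!: derivative_eq_intros mu'[OF p])
  then have "((\<lambda>j. fst (snd (fst j)) * \<mu>' (fst (snd (snd (fst j)))) * fst (snd j)) has_derivative
     (\<lambda>((_, dy, dw, _), dwx, _). dy * \<mu>' w * wx + y * \<mu>'' w * dw * wx + y * \<mu>' w * dwx)) (at ?j)"
    by (auto intro!: derivative_eq_intros simp: fun_eq_iff algebra_simps)
  then show ?thesis
    \<comment> \<open>The closed form of the coefficient holds on the cylinder of jets over
      \<open>\<Omega>\<close>, which is open, so it may be differentiated.\<close>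
    by (intro frechet_derivative_at[symmetric],
        elim has_derivative_transform_within_open[OF _ open_vimage_fst[OF open_dom]])
      (use p in \<open>auto simp: coeff1_phi_x\<close>)
qed

lemma D_coeff1_phi_y:
  assumes p: "(x, y, w, E) \<in> \<Omega>"
  shows "frechet_derivative (coeff1 Dy0 \<xi> (\<lambda>_. 1) \<phi> w_x w_y) (at ((x, y, w, E), wx, wy, ex, ey)) =
    (\<lambda>((_, dy, dw, _), _, dwy, _).
      \<mu>' w * dw + dy * \<mu>' w * wy + y * \<mu>'' w * dw * wy + y * \<mu>' w * dwy)"
proof -
  let ?j = "((x, y, w, E), wx, wy, ex, ey)"
  have "((\<lambda>j. \<mu> (fst (snd (snd (fst j))))) has_derivative (\<lambda>v. fst (snd (snd (fst v))) * \<mu>' w)) (at ?j)"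
    by (rule DERIV_compose_FDERIV) (auto intro!: derivative_eq_intros mu[OF p])
  moreover have "((\<lambda>j. \<mu>' (fst (snd (snd (fst j))))) has_derivative
      (\<lambda>v. fst (snd (snd (fst v))) * \<mu>'' w)) (at ?j)"
    by (rule DERIV_compose_FDERIV) (auto intro!: derivative_eq_intros mu'[OF p])
  ultimately have "((\<lambda>j. \<mu> (fst (snd (snd (fst j))))
      + fst (snd (fst j)) * \<mu>' (fst (snd (snd (fst j)))) * fst (snd (snd j))) has_derivative
     (\<lambda>((_, dy, dw, _), _, dwy, _).
      \<mu>' w * dw + dy * \<mu>' w * wy + y * \<mu>'' w * dw * wy + y * \<mu>' w * dwy)) (at ?j)"
    by (auto intro!: derivative_eq_intros simp: fun_eq_iff algebra_simps)
  then show ?thesis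
    by (intro frechet_derivative_at[symmetric],
        elim has_derivative_transform_within_open[OF _ open_vimage_fst[OF open_dom]])
      (use p in \<open>auto simp: coeff1_phi_y\<close>)
qed

text \<open>\<open>F\<close> contains no second derivative of \<open>E\<close>, so only first
  derivatives of \<open>\<psi>\<close> enter. The terms of the second prolongation linear in
  \<open>w_xx\<close> and \<open>w_yy\<close> are collected with \<open>\<psi>\<close> in front of
  \<open>w_xx + w_yy\<close>, the combination that \<open>F = 0\<close> eliminates.\<close>

lemma pr2_eqn_F:
  assumes p: "(x, y, w, E) \<in> \<Omega>"
  shows "vf_apply (pr2 \<xi> (\<lambda>_. 1) \<phi> \<psi>) eqn_F
      (((x, y, w, E), wx, wy, ex, ey), wxx, wxy, wyy, exx, exy, eyy) =
    y * \<mu>' w * wx * ex + wx * D\<psi> (x, y, w, E) (1, 0, wx, ex)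
    + (\<mu> w + y * \<mu>' w * wy) * ey + wy * D\<psi> (x, y, w, E) (0, 1, wy, ey)
    + (\<psi> (x, y, w, E) + E * y * \<mu>' w) * (wxx + wyy)
    + E * (y * \<mu>'' w * (wx\<^sup>2 + wy\<^sup>2) + 2 * \<mu>' w * wy)"
  using p
  by (simp add: vf_apply_eqn_F pr1_def Let_def coeff1_phi_x coeff1_phi_y coeff1_psi_x coeff1_psi_y D_xi
      D_coeff1_phi_x D_coeff1_phi_y power2_eq_square algebra_simps)

section \<open>Invariant surface conditions\<close>

lemma D_surf_w:
  assumes p: "(x, y, w, E) \<in> \<Omega>"
  shows "frechet_derivative (surf_w \<xi> \<phi>) (at ((x, y, w, E), wx, wy, ex, ey)) =
    (\<lambda>((_, dy, dw, _), _, dwy, _). dwy - dy * \<mu> w - y * \<mu>' w * dw)"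
proof -
  let ?j = "((x, y, w, E), wx, wy, ex, ey)"
  have "((\<lambda>j. \<phi> (fst j)) has_derivative
      (\<lambda>v. (\<lambda>(_, dy, dw, _). dy * \<mu> w + y * \<mu>' w * dw) (fst v))) (at ?j)"
    by (rule has_derivative_compose[where f = fst and g = \<phi>])
      (auto intro!: derivative_eq_intros D_phi[OF p])
  then have "((\<lambda>j. fst (snd (snd j)) - \<phi> (fst j)) has_derivative
      (\<lambda>((_, dy, dw, _), _, dwy, _). dwy - dy * \<mu> w - y * \<mu>' w * dw)) (at ?j)"
    by (auto intro!: derivative_eq_intros simp: fun_eq_iff)
  then show ?thesis
    by (intro frechet_derivative_at[symmetric],
        elim has_derivative_transform_within_open[OF _ open_vimage_fst[OF open_dom]])
      (use p in \<open>auto simp: surf_w_def xi w_y_def\<close>)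
qed

lemma D_surf_E:
  assumes p: "p \<in> \<Omega>"
  shows "frechet_derivative (surf_E \<xi> \<psi>) (at (p, wx, wy, ex, ey)) =
    (\<lambda>(v, _, _, _, dey). dey - D\<psi> p v)"
proof -
  let ?j = "(p, wx, wy, ex, ey)"
  have "((\<lambda>j. \<psi> (fst j)) has_derivative (\<lambda>v. D\<psi> p (fst v))) (at ?j)"
    by (rule has_derivative_compose[where f = fst and g = \<psi>])
      (use psi[OF p] in \<open>auto intro!: derivative_eq_intros simp: frechet_derivative_works\<close>)
  then have "((\<lambda>j. snd (snd (snd (snd j))) - \<psi> (fst j)) has_derivative
      (\<lambda>(v, _, _, _, dey). dey - D\<psi> p v)) (at ?j)"
    by (auto intro!: derivative_eq_intros simp: fun_eq_iff)
  then show ?thesis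
    by (intro frechet_derivative_at[symmetric],
        elim has_derivative_transform_within_open[OF _ open_vimage_fst[OF open_dom]])
      (use p in \<open>auto simp: surf_E_def xi E_y_def\<close>)
qed

text \<open>The prolonged field maps \<open>w_y - y \<mu>\<close> to \<open>y \<mu>'\<close> times
  itself.\<close>

lemma pr1_surf_w:
  assumes "(x, y, w, E) \<in> \<Omega>" "surf_w \<xi> \<phi> ((x, y, w, E), wx, wy, ex, ey) = 0"
  shows "vf_apply (pr1 \<xi> (\<lambda>_. 1) \<phi> \<psi>) (surf_w \<xi> \<phi>) ((x, y, w, E), wx, wy, ex, ey) = 0"
  using assms by (simp add: vf_apply_def D_surf_w pr1_def coeff1_phi_y)
    (simp add: surf_w_def xi phi w_y_def)

text \<open>The result is the difference of \<open>D\<psi>\<close> at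
  \<open>(0, 1, w_y, E_y)\<close> and at \<open>(0, 1, \<phi>, \<psi>)\<close>, and these directions
  agree on the surface. Hence all restrictions on \<open>\<psi>\<close> come from the condition on
  \<open>F\<close>.\<close>

lemma pr1_surf_E:
  assumes "p \<in> \<Omega>" "surf_w \<xi> \<phi> (p, wx, wy, ex, ey) = 0" "surf_E \<xi> \<psi> (p, wx, wy, ex, ey) = 0"
  shows "vf_apply (pr1 \<xi> (\<lambda>_. 1) \<phi> \<psi>) (surf_E \<xi> \<psi>) (p, wx, wy, ex, ey) = 0"
  using assms by (simp add: vf_apply_def D_surf_E pr1_def coeff1_psi_y)
    (simp add: surf_w_def surf_E_def xi w_y_def E_y_def)

subsection \<open>The determining equation\<close>

text \<open>On the invariant surface \<open>w_y = \<phi>\<close> and \<open>E_y = \<psi>\<close>, and \<open>F = 0\<close> is solved for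
  \<open>w_xx + w_yy\<close>; the derivatives \<open>w_x\<close> and \<open>E_x\<close> remain free.\<close>

lemma nonclassical_generator_determining_equation:
  assumes "nonclassical_generator eqn_F \<Omega> \<xi> \<phi> \<psi>" and p: "(x, y, w, E) \<in> \<Omega>" and "E \<noteq> 0"
  defines "u \<equiv> y * \<mu> w" and "v \<equiv> \<psi> (x, y, w, E)"
  shows "y * \<mu>' w * wx * ex + wx * D\<psi> (x, y, w, E) (1, 0, wx, ex)
    + (\<mu> w + y * \<mu>' w * u) * v + u * D\<psi> (x, y, w, E) (0, 1, u, v)
    - (v / E + y * \<mu>' w) * (1 + wx * ex + u * v)
    + E * (y * \<mu>'' w * (wx\<^sup>2 + u\<^sup>2) + 2 * \<mu>' w * u) = 0"
proof -
  \<comment> \<open>A jet over arbitrary \<open>wx\<close>, \<open>ex\<close>: \<open>F = 0\<close>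
    forces \<open>wxx\<close>, the total derivatives of the surface functions force
    \<open>w_xy\<close>, \<open>w_yy\<close>, \<open>E_xy\<close>, \<open>E_yy\<close>, and the
    unconstrained \<open>E_xx\<close> is set to 0.\<close>
  define wyy where "wyy = \<mu> w + y * \<mu>' w * u"
  define wxx where "wxx = - (1 + wx * ex + u * v) / E - wyy"
  let ?j = "(((x, y, w, E), wx, u, ex, v), wxx, y * \<mu>' w * wx, wyy,
      0, D\<psi> (x, y, w, E) (1, 0, wx, ex), D\<psi> (x, y, w, E) (0, 1, u, v)) :: jet2"
  have "eqn_F ?j = 0" using \<open>E \<noteq> 0\<close> by (simp add: wxx_def)
  moreover have "surf_w \<xi> \<phi> (fst ?j) = 0" "surf_E \<xi> \<psi> (fst ?j) = 0"
    using p by (simp_all add: surf_w_def surf_E_def xi phi w_y_def E_y_def u_def v_def)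
  moreover have "Dx1 (surf_w \<xi> \<phi>) ?j = 0" "Dy1 (surf_w \<xi> \<phi>) ?j = 0"
      "Dx1 (surf_E \<xi> \<psi>) ?j = 0" "Dy1 (surf_E \<xi> \<psi>) ?j = 0"
    using p by (simp_all add: D_surf_w D_surf_E wyy_def)
  moreover have "fst (fst ?j) \<in> \<Omega>" using p by simp
  ultimately have "vf_apply (pr2 \<xi> (\<lambda>_. 1) \<phi> \<psi>) eqn_F ?j = 0"
    using assms(1) unfolding nonclassical_generator_def by blast
  moreover have "(v + E * y * \<mu>' w) * (wxx + wyy) = - ((v / E + y * \<mu>' w) * (1 + wx * ex + u * v))"
    using \<open>E \<noteq> 0\<close> by (simp add: wxx_def field_simps)
  ultimately show ?thesis
    unfolding pr2_eqn_F[OF p] by (simp add: v_def)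
qed

lemma D_psi_linear:
  assumes "p \<in> \<Omega>"
  shows "D\<psi> p (a, b, c, d) = a * D\<psi> p (1, 0, 0, 0) + b * D\<psi> p (0, 1, 0, 0)
    + c * D\<psi> p (0, 0, 1, 0) + d * D\<psi> p (0, 0, 0, 1)"
proof -
  have lin: "linear (D\<psi> p)" by (rule linear_frechet_derivative[OF psi[OF assms]])
  have "(a, b, c, d) = a *\<^sub>R (1, 0, 0, 0) + b *\<^sub>R (0, 1, 0, 0) + c *\<^sub>R (0, 0, 1, 0)
      + d *\<^sub>R (0 :: real, 0 :: real, 0 :: real, 1 :: real)"
    by simp
  then show ?thesis by (simp only: linear_add[OF lin] linear_scale[OF lin] real_scaleR_def)
qed

lemma D_psi_y:
  assumes p: "(x, y, w, E) \<in> \<Omega>"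
  shows "((\<lambda>t. \<psi> (x, t, w, E)) has_real_derivative D\<psi> (x, y, w, E) (0, 1, 0, 0)) (at y)"
proof -
  have "((\<lambda>t. (x, t, w, E)) has_derivative (\<lambda>h. (0, h, 0, 0))) (at y)"
    by (auto intro!: derivative_eq_intros simp: zero_prod_def)
  from has_derivative_compose[OF this psi[OF p, unfolded frechet_derivative_works]]
  show ?thesis
    unfolding has_field_derivative_def
    by (rule has_derivative_eq_rhs) (rule ext, subst D_psi_linear[OF p], simp)
qed

lemma D_psi_E:
  assumes p: "(x, y, w, E) \<in> \<Omega>"
  shows "((\<lambda>t. \<psi> (x, y, w, t)) has_real_derivative D\<psi> (x, y, w, E) (0, 0, 0, 1)) (at E)"
proof -
  have "((\<lambda>t. (x, y, w, t)) has_derivative (\<lambda>h. (0, 0, 0, h))) (at E)"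
    by (auto intro!: derivative_eq_intros)
  from has_derivative_compose[OF this psi[OF p, unfolded frechet_derivative_works]]
  show ?thesis
    unfolding has_field_derivative_def
    by (rule has_derivative_eq_rhs) (rule ext, subst D_psi_linear[OF p], simp)
qed

lemma determining_equation_coefficients:
  assumes gen: "nonclassical_generator eqn_F \<Omega> \<xi> \<phi> \<psi>" and p: "(x, y, w, E) \<in> \<Omega>" and "E \<noteq> 0"
  shows "D\<psi> (x, y, w, E) (0, 0, 0, 1) = \<psi> (x, y, w, E) / E"
    and "\<psi> (x, y, w, E) / E + y * \<mu>' w =
      \<mu> w * \<psi> (x, y, w, E) + y * \<mu> w * D\<psi> (x, y, w, E) (0, 1, 0, 0) + 2 * E * \<mu>' w * (y * \<mu> w)"
proof -
  define X Y W Z where "X = D\<psi> (x, y, w, E) (1, 0, 0, 0)" and "Y = D\<psi> (x, y, w, E) (0, 1, 0, 0)"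
    and "W = D\<psi> (x, y, w, E) (0, 0, 1, 0)" and "Z = D\<psi> (x, y, w, E) (0, 0, 0, 1)"
  define u v r where "u = y * \<mu> w" and "v = \<psi> (x, y, w, E)" and "r = v / E"
  have D: "D\<psi> (x, y, w, E) (a, b, c, d) = a * X + b * Y + c * W + d * Z" for a b c d
    unfolding X_def Y_def W_def Z_def by (rule D_psi_linear[OF p])
  have eq: "y * \<mu>' w * wx * ex + wx * (X + wx * W + ex * Z)
      + (\<mu> w + y * \<mu>' w * u) * v + u * (Y + u * W + v * Z)
      - (r + y * \<mu>' w) * (1 + wx * ex + u * v)
      + E * (y * \<mu>'' w * (wx\<^sup>2 + u\<^sup>2) + 2 * \<mu>' w * u) = 0" for wx ex
    using nonclassical_generator_determining_equation[OF assms, of wx ex]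
    unfolding D u_def v_def r_def by simp
  \<comment> \<open>The difference of the two instances is the coefficient of
    \<open>w_x E_x\<close>, in which \<open>y * \<mu>' w\<close> cancels.\<close>
  have Z: "Z = r" using eq[of 1 0] eq[of 1 1] by (simp add: algebra_simps)
  then show "D\<psi> (x, y, w, E) (0, 0, 0, 1) = \<psi> (x, y, w, E) / E"
    by (simp add: Z_def r_def v_def)
  \<comment> \<open>The sum of the instances at \<open>wx = 1\<close> and \<open>wx = -1\<close>
    minus twice the one at 0 isolates the coefficient of \<open>w_x\<^sup>2\<close>.\<close>
  have W: "W = - E * y * \<mu>'' w"
    using eq[of 0 0] eq[of 1 0] eq[of "-1" 0] by (simp add: algebra_simps)
  \<comment> \<open>In the constant term the products with \<open>u * v\<close> cancel by the value
    of \<open>Z\<close>, those with \<open>u\<^sup>2\<close> by the value of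
    \<open>W\<close>.\<close>
  have "r + y * \<mu>' w = \<mu> w * v + u * Y + 2 * E * \<mu>' w * u"
    using eq[of 0 0] unfolding Z W by (simp add: algebra_simps power2_eq_square)
  then show "\<psi> (x, y, w, E) / E + y * \<mu>' w =
      \<mu> w * \<psi> (x, y, w, E) + y * \<mu> w * D\<psi> (x, y, w, E) (0, 1, 0, 0) + 2 * E * \<mu>' w * (y * \<mu> w)"
    by (simp add: r_def v_def u_def Y_def)
qed

text \<open>Since \<open>\<psi> / E\<close> does not depend on \<open>E\<close>, replacing \<open>E\<close> by a nearby \<open>E'\<close> in the second
  coefficient equation keeps its left-hand side and multiplies its right-hand side by \<open>E' / E\<close>.\<close>

lemma psi_unique:
  assumes gen: "nonclassical_generator eqn_F \<Omega> \<xi> \<phi> \<psi>" and p: "(x, y, w, E) \<in> \<Omega>"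
    and nz: "\<And>x y w E. (x, y, w, E) \<in> \<Omega> \<Longrightarrow> E \<noteq> 0"
  shows "\<psi> (x, y, w, E) = - y * \<mu>' w * E"
proof -
  \<comment> \<open>With \<open>x\<close> and \<open>w\<close> fixed, a box in the
    \<open>(y, E)\<close> plane is needed: \<open>E\<close> moves along a segment in
    \<open>V\<close>, and the resulting relation must hold for all \<open>y'\<close> in
    \<open>U\<close> so that it can be differentiated in \<open>y\<close>.\<close>
  have "open ((\<lambda>q. (x, fst q, w, snd q)) -` \<Omega>)"
    by (intro open_vimage open_dom continuous_intros)
  moreover have "(y, E) \<in> (\<lambda>q. (x, fst q, w, snd q)) -` \<Omega>" using p by simp
  ultimately obtain U V where U: "open U" "y \<in> U" and V: "open V" "E \<in> V"
    and UV: "U \<times> V \<subseteq> (\<lambda>q. (x, fst q, w, snd q)) -` \<Omega>"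
    by (rule open_prod_elim) auto
  then have mem: "(x, y', w, E') \<in> \<Omega>" if "y' \<in> U" "E' \<in> V" for y' E' using that by fastforce
  obtain d where "d > 0" and d: "cball E d \<subseteq> V"
    using V open_contains_cball by blast
  define E' where "E' = E + d"
  have E': "E' \<in> V" and seg: "{E..E'} \<subseteq> V" and "E < E'"
    using d \<open>d > 0\<close> by (auto simp: E'_def cball_def dist_real_def subset_eq)
  have nzE: "E \<noteq> 0" "E' \<noteq> 0" using nz mem[OF U(2)] V(2) E' by blast+
  have ratio: "\<psi> (x, y', w, E') = E' / E * \<psi> (x, y', w, E)" if y': "y' \<in> U" for y'
  proof -
    \<comment> \<open>By the first coefficient equation the quotient rule gives derivative 0, so the
      quotient is constant along the segment.\<close>
    have "((\<lambda>t. \<psi> (x, y', w, t) / t) has_real_derivative 0) (at t)" if "t \<in> {E..E'}" for t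
    proof -
      have t: "(x, y', w, t) \<in> \<Omega>" "t \<noteq> 0" using mem[OF y'] seg that nz by blast+
      from D_psi_E[OF t(1)] t(2) show ?thesis
        by (auto intro!: derivative_eq_intros
            simp: determining_equation_coefficients(1)[OF gen t])
    qed
    then have "\<psi> (x, y', w, E') / E' = \<psi> (x, y', w, E) / E"
      using DERIV_isconst_end[OF \<open>E < E'\<close>, of "\<lambda>t. \<psi> (x, y', w, t) / t"]
      by (meson DERIV_isCont atLeastAtMost_iff continuous_at_imp_continuous_on less_imp_le)
    then show ?thesis using nzE by (simp add: field_simps)
  qed
  have p': "(x, y, w, E') \<in> \<Omega>" using mem[OF U(2) E'] .
  have "((\<lambda>t. \<psi> (x, t, w, E')) has_real_derivative E' / E * D\<psi> (x, y, w, E) (0, 1, 0, 0)) (at y)"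
    by (rule has_field_derivative_transform_within_open[OF DERIV_cmult[OF D_psi_y[OF p]] U])
      (simp add: ratio)
  then have Y: "D\<psi> (x, y, w, E') (0, 1, 0, 0) = E' / E * D\<psi> (x, y, w, E) (0, 1, 0, 0)"
    using D_psi_y[OF p'] DERIV_unique by blast
  define c where "c = \<psi> (x, y, w, E) / E + y * \<mu>' w"
  have c: "c = \<mu> w * \<psi> (x, y, w, E) + y * \<mu> w * D\<psi> (x, y, w, E) (0, 1, 0, 0)
      + 2 * E * \<mu>' w * (y * \<mu> w)"
    unfolding c_def by (rule determining_equation_coefficients(2)[OF gen p nzE(1)])
  \<comment> \<open>By \<open>ratio\<close>, \<open>c\<close> is also the left-hand side at
    \<open>E'\<close>; since \<open>E'\<close> differs from \<open>E\<close>, this forces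
    \<open>c = 0\<close>, which is the claimed formula.\<close>
  have "c = E' / E * c"
    using determining_equation_coefficients(2)[OF gen p' nzE(2)] nzE
    unfolding Y ratio[OF U(2)] by (subst (2) c) (simp add: c_def field_simps)
  then have "c = 0" using \<open>E < E'\<close> nzE by (simp add: field_simps)
  then show ?thesis using nzE by (simp add: c_def field_simps)
qed

section \<open>Verification of the explicit generator\<close>

text \<open>The coefficient \<open>\<psi> + E y \<mu>'\<close> of \<open>w_xx + w_yy\<close>
  vanishes, and the other terms reduce to \<open>\<mu> E_y + E \<mu>' w_y\<close>, which is 0 on the
  invariant surface.\<close>

lemma nonclassical_generator_if_psi_eq:
  assumes psi_eq: "\<And>x y w E. (x, y, w, E) \<in> \<Omega> \<Longrightarrow> \<psi> (x, y, w, E) = - y * \<mu>' w * E"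
    and "\<xi> real_analytic_on \<Omega>" "\<phi> real_analytic_on \<Omega>" "\<psi> real_analytic_on \<Omega>"
  shows "nonclassical_generator eqn_F \<Omega> \<xi> \<phi> \<psi>"
proof -
  have D: "D\<psi> (x, y, w, E) =
      (\<lambda>(_, dy, dw, dE). - (dy * \<mu>' w * E + y * \<mu>'' w * dw * E + y * \<mu>' w * dE))"
    if p: "(x, y, w, E) \<in> \<Omega>" for x y w E
  proof -
    let ?p = "(x, y, w, E)"
    have "((\<lambda>p. \<mu>' (fst (snd (snd p)))) has_derivative (\<lambda>v. fst (snd (snd v)) * \<mu>'' w)) (at ?p)"
      by (rule DERIV_compose_FDERIV) (auto intro!: derivative_eq_intros mu'[OF p])
    then have "((\<lambda>p. - (fst (snd p) * \<mu>' (fst (snd (snd p))) * snd (snd (snd p)))) has_derivative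
        (\<lambda>(_, dy, dw, dE). - (dy * \<mu>' w * E + y * \<mu>'' w * dw * E + y * \<mu>' w * dE))) (at ?p)"
      by (auto intro!: derivative_eq_intros simp: fun_eq_iff algebra_simps)
    then show ?thesis
      by (intro frechet_derivative_at[symmetric],
          elim has_derivative_transform_within_open[OF _ open_dom p]) (auto simp: psi_eq)
  qed
  have "vf_apply (pr2 \<xi> (\<lambda>_. 1) \<phi> \<psi>) eqn_F
      (((x, y, w, E), wx, wy, ex, ey), wxx, wxy, wyy, exx, exy, eyy) = 0"
    if p: "(x, y, w, E) \<in> \<Omega>"
      and "surf_w \<xi> \<phi> ((x, y, w, E), wx, wy, ex, ey) = 0"
      and "surf_E \<xi> \<psi> ((x, y, w, E), wx, wy, ex, ey) = 0"
    for x y w E wx wy ex ey wxx wxy wyy exx exy eyy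
  proof -
    have "wy = y * \<mu> w" "ey = - y * \<mu>' w * E"
      using that by (simp_all add: surf_w_def surf_E_def xi phi psi_eq w_y_def E_y_def)
    then show ?thesis
      unfolding pr2_eqn_F[OF p] D[OF p] psi_eq[OF p]
      by (simp add: algebra_simps power2_eq_square)
  qed
  then show ?thesis
    unfolding nonclassical_generator_def using assms(2-4) pr1_surf_w pr1_surf_E by auto
qed

end

section \<open>Existence and uniqueness on a given domain\<close>

theorem proposition4:
  fixes \<Omega> :: "jet0 set" and S :: "real set"
    and A :: "real \<Rightarrow> real \<Rightarrow> real" and G :: "real \<Rightarrow> real \<Rightarrow> real \<Rightarrow> real" and \<mu> :: "real \<Rightarrow> real"
  assumes "open \<Omega>" and "\<And>x y w E. (x, y, w, E) \<in> \<Omega> \<Longrightarrow> E \<noteq> 0"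
    and "open S" and "\<mu> real_analytic_on S"
    and "\<And>x y w E. (x, y, w, E) \<in> \<Omega> \<Longrightarrow> w \<in> S"
    and "\<And>x y w E. (x, y, w, E) \<in> \<Omega> \<Longrightarrow> A x y = 0"
    and "\<And>x y w E. (x, y, w, E) \<in> \<Omega> \<Longrightarrow> G x y w = y * \<mu> w"
  shows "nonclassical_generator eqn_F \<Omega>
           (\<lambda>(x, y, w, E). 0) (\<lambda>(x, y, w, E). y * \<mu> w) (\<lambda>(x, y, w, E). - y * deriv \<mu> w * E) \<and>
         (\<forall>\<xi> \<phi> \<psi>. nonclassical_generator eqn_F \<Omega> \<xi> \<phi> \<psi> \<and>
            (\<forall>(x, y, w, E)\<in>\<Omega>. \<xi> (x, y, w, E) = A x y \<and> \<phi> (x, y, w, E) = G x y w) \<longrightarrow>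
            (\<forall>(x, y, w, E)\<in>\<Omega>. \<xi> (x, y, w, E) = 0 \<and> \<phi> (x, y, w, E) = y * \<mu> w \<and>
               \<psi> (x, y, w, E) = - y * deriv \<mu> w * E))"
proof -
  have mu: "(\<mu> has_real_derivative deriv \<mu> w) (at w)"
    and mu': "(deriv \<mu> has_real_derivative deriv (deriv \<mu>) w) (at w)"
    if "(x, y, w, E) \<in> \<Omega>" for x y w E
    using real_analytic_on_imp_differentiable[of _ S w] real_analytic_on_deriv assms(4) assms(5)[OF that]
    by (auto simp: DERIV_deriv_iff_real_differentiable)
  have candidate: "nonclassical_candidate \<Omega> \<mu> (deriv \<mu>) (deriv (deriv \<mu>)) \<xi> \<phi> \<psi>"
    if "\<And>p. p \<in> \<Omega> \<Longrightarrow> \<xi> p = 0" "\<And>x y w E. (x, y, w, E) \<in> \<Omega> \<Longrightarrow> \<phi> (x, y, w, E) = y * \<mu> w"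
      and "\<psi> real_analytic_on \<Omega>" for \<xi> \<phi> \<psi>
    by unfold_locales
      (use that assms(1) mu mu' in \<open>auto intro: real_analytic_on_imp_differentiable\<close>)
  \<comment> \<open>Unit vectors for \<open>w\<close>, \<open>y\<close> and \<open>E\<close>: with
    them \<open>\<phi>\<close> and \<open>\<psi>\<close> are built from a function of
    \<open>w\<close> by multiplying with coordinates and negating, so the closure lemmas give
    analyticity.\<close>
  define e_w e_y e_E :: jet0 where "e_w = (0, 0, 1, 0)" and "e_y = (0, 1, 0, 0)" and "e_E = (0, 0, 0, 1)"
  have basis: "e_w \<in> Basis" "e_y \<in> Basis" "e_E \<in> Basis"
    by (simp_all add: e_w_def e_y_def e_E_def Basis_prod_def zero_prod_def image_iff)
  have coord: "(\<lambda>p. f (p \<bullet> e_w)) real_analytic_on \<Omega>" if "f real_analytic_on S" for f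
  proof (rule real_analytic_on_subset[OF real_analytic_on_coordinate[OF basis(1)]])
    show "\<Omega> \<subseteq> {p. p \<bullet> e_w \<in> S}"
      using assms(5)[of "fst p" "fst (snd p)" "fst (snd (snd p))" "snd (snd (snd p))" for p]
      by (simp add: e_w_def inner_prod_def subset_eq)
    show "\<exists>c. \<exists>r>0. \<forall>x\<in>ball a r. ((\<lambda>n. c n * (x - a) ^ n) has_sum f x) UNIV" if "a \<in> S" for a
      by (rule real_analytic_on_power_series[OF \<open>f real_analytic_on S\<close> that])
  qed
  have "(\<lambda>p. (p \<bullet> e_y) * \<mu> (p \<bullet> e_w)) real_analytic_on \<Omega>"
    by (intro real_analytic_on_mult_coordinate basis coord assms(4))
  then have phi: "(\<lambda>(x, y, w, E). y * \<mu> w) real_analytic_on \<Omega>"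
    by (simp add: e_w_def e_y_def case_prod_unfold inner_prod_def)
  have "(\<lambda>p. - ((p \<bullet> e_E) * ((p \<bullet> e_y) * deriv \<mu> (p \<bullet> e_w)))) real_analytic_on \<Omega>"
    by (intro real_analytic_on_uminus real_analytic_on_mult_coordinate basis coord
        real_analytic_on_deriv assms(4))
  then have psi: "(\<lambda>(x, y, w, E). - y * deriv \<mu> w * E) real_analytic_on \<Omega>"
    by (simp add: e_w_def e_y_def e_E_def case_prod_unfold inner_prod_def mult_ac)
  have xi: "(\<lambda>(x, y, w, E). 0 :: real) real_analytic_on \<Omega>"
    unfolding real_analytic_on_def by (auto intro!: exI[of _ "\<lambda>_. 0"] exI[of _ 1])
  show ?thesis
  proof (intro conjI allI impI)
    show "nonclassical_generator eqn_F \<Omega>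
        (\<lambda>(x, y, w, E). 0) (\<lambda>(x, y, w, E). y * \<mu> w) (\<lambda>(x, y, w, E). - y * deriv \<mu> w * E)"
      by (rule nonclassical_candidate.nonclassical_generator_if_psi_eq[OF candidate])
        (use xi phi psi in auto)
  next
    fix \<xi> \<phi> \<psi>
    assume *: "nonclassical_generator eqn_F \<Omega> \<xi> \<phi> \<psi> \<and>
      (\<forall>(x, y, w, E)\<in>\<Omega>. \<xi> (x, y, w, E) = A x y \<and> \<phi> (x, y, w, E) = G x y w)"
    then have eqs: "\<xi> (x, y, w, E) = 0" "\<phi> (x, y, w, E) = y * \<mu> w" if "(x, y, w, E) \<in> \<Omega>" for x y w E
      using assms(6,7) that by fastforce+
    have "\<psi> real_analytic_on \<Omega>" using * by (simp add: nonclassical_generator_def)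
    then have "nonclassical_candidate \<Omega> \<mu> (deriv \<mu>) (deriv (deriv \<mu>)) \<xi> \<phi> \<psi>"
      using eqs by (intro candidate) auto
    from nonclassical_candidate.psi_unique[OF this] * eqs assms(2)
    show "\<forall>(x, y, w, E)\<in>\<Omega>. \<xi> (x, y, w, E) = 0 \<and> \<phi> (x, y, w, E) = y * \<mu> w \<and>
        \<psi> (x, y, w, E) = - y * deriv \<mu> w * E"
      by blast
  qed
qed

end
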